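(* The graph of the prevalent $f\in \mathrm{Homeo}([0,1])$ is of length $2$. That is, the set $\{f\in \mathrm{Homeo}([0,1]) : \operatorname{length}(\operatorname{graph}(f))=2\}$ is prevalent in the Polish group $\mathrm{Homeo}([0,1])$.
   Context: $\mathrm{Homeo}([0,1])$ is the group (under composition) of homeomorphisms of $[0,1]$, with the topology of the maximum metric $\max_x|f(x)-g(x)|$; it is a Polish group. A subset $X$ of a Polish group $G$ is Haar null if there exist a Borel probability measure $\mu$ on $G$ and a Borel set $B\supseteq X$ such that $\mu(gBh)=0$ for all $g,h\in G$; the complement of a Haar null set is called prevalent. For a function $f\colon[0,1]\to[0,1]$, $\operatorname{length}(\operatorname{graph}(f))=\sup\sum_{i=1}^n|\gamma(x_i)-\gamma(x_{i-1})|$, where $\gamma(x)=(x,f(x))$, $|\cdot|$ is the Euclidean norm and the supremum is over all $n\ge1$ and $0=x_0<\dots<x_n=1$. *)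

theory Defs
  imports "HOL-Probability.Probability_Measure" "HOL-Algebra.Bij"
begin

section \<open>Haar null and prevalent sets\<close>

definition borel_of :: "'a topology \<Rightarrow> 'a measure" where
  "borel_of T = sigma (topspace T) {U. openin T U}"

text \<open>
  \<open>T\<close> is meant to be a Polish group topology on \<open>carrier G\<close>. The two-sided translate \<open>g B h\<close> of a
  Borel set is then again Borel, so \<open>emeasure\<close> is not evaluated outside \<open>sets \<mu>\<close>, where it would
  be 0 by convention.
\<close>

definition haar_null :: "('a, 'b) monoid_scheme \<Rightarrow> 'a topology \<Rightarrow> 'a set \<Rightarrow> bool" where
  "haar_null G T X \<longleftrightarrow> X \<subseteq> carrier G \<and>
    (\<exists>\<mu> B. prob_space \<mu> \<and> sets \<mu> = sets (borel_of T) \<and> B \<in> sets (borel_of T) \<and> X \<subseteq> B \<and>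
      (\<forall>g\<in>carrier G. \<forall>h\<in>carrier G. emeasure \<mu> ((\<lambda>b. g \<otimes>\<^bsub>G\<^esub> b \<otimes>\<^bsub>G\<^esub> h) ` B) = 0))"

definition prevalent :: "('a, 'b) monoid_scheme \<Rightarrow> 'a topology \<Rightarrow> 'a set \<Rightarrow> bool" where
  "prevalent G T X \<longleftrightarrow> X \<subseteq> carrier G \<and> haar_null G T (carrier G - X)"


section \<open>The group of homeomorphisms of the unit interval\<close>

text \<open>
  A self-map of the unit interval is represented by the function on \<open>real\<close> that is \<open>undefined\<close>
  outside of \<open>{0..1}\<close>, so that equality of group elements is equality on \<open>{0..1}\<close>.
  Multiplication, inherited from \<open>BijGroup\<close>, is composition restricted to \<open>{0..1}\<close>.
\<close>

definition Homeo :: "(real \<Rightarrow> real) monoid" where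
  "Homeo = (BijGroup {0..1})
     \<lparr>carrier := {f \<in> extensional {0..1}. \<exists>g. homeomorphism {0..1} {0..1} f g}\<rparr>"

text \<open>
  The supremum is a maximum, by compactness of \<open>{0..1}\<close>. The value 0 outside of the carrier is only
  there because \<open>Metric_space\<close> asks for a distance that is nonnegative everywhere.
\<close>

definition max_dist :: "(real \<Rightarrow> real) \<Rightarrow> (real \<Rightarrow> real) \<Rightarrow> real" where
  "max_dist f g = (if f \<in> carrier Homeo \<and> g \<in> carrier Homeo
     then SUP x\<in>{0..1}. \<bar>f x - g x\<bar> else 0)"

definition Homeo_topology :: "(real \<Rightarrow> real) topology" where
  "Homeo_topology = Metric_space.mtopology (carrier Homeo) max_dist"

lemma carrier_Homeo:
  "carrier Homeo = {f \<in> extensional {0..1}. \<exists>g. homeomorphism {0..1} {0..1} f g}"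
  by (simp add: Homeo_def)

lemma mult_Homeo:
  assumes "f \<in> carrier Homeo" "g \<in> carrier Homeo"
  shows "f \<otimes>\<^bsub>Homeo\<^esub> g = compose {0..1} f g"
proof -
  have "f \<in> Bij {0..1} \<and> g \<in> Bij {0..1}"
    using assms by (auto simp: carrier_Homeo Bij_def homeomorphism_def bij_betw_def
        intro: inj_on_inverseI)
  then show ?thesis
    by (simp add: Homeo_def BijGroup_def)
qed

lemma group_Homeo: "group Homeo"
proof -
  interpret B: group "BijGroup {0..1::real}"
    by (rule group_BijGroup)
  have Bij: "f \<in> Bij {0..1}" if "f \<in> extensional {0..1}" "homeomorphism {0..1} {0..1} f g"
    for f g :: "real \<Rightarrow> real"
    using that by (auto simp: Bij_def homeomorphism_def bij_betw_def intro: inj_on_inverseI)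
  have "subgroup (carrier Homeo) (BijGroup {0..1})"
  proof (rule B.subgroupI)
    show "carrier Homeo \<subseteq> carrier (BijGroup {0..1})"
      using Bij by (auto simp: carrier_Homeo BijGroup_def)
    have "homeomorphism {0..1::real} {0..1} (\<lambda>x\<in>{0..1}. x) (\<lambda>x. x)"
      by (rule homeomorphism_cong[OF homeomorphism_ident]) auto
    then show "carrier Homeo \<noteq> {}"
      using restrict_extensional by (fastforce simp: carrier_Homeo)
  next
    fix f assume "f \<in> carrier Homeo"
    then obtain g where f: "f \<in> extensional {0..1}" "homeomorphism {0..1} {0..1} f g"
      by (auto simp: carrier_Homeo)
    have "restrict g {0..1} = (\<lambda>x\<in>{0..1}. inv_into {0..1} f x)"
      using f(2) by (intro restrict_ext)
        (metis homeomorphism_def imageI inv_into_f_f inj_on_inverseI)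
    then have "inv\<^bsub>BijGroup {0..1}\<^esub> f = restrict g {0..1}"
      using inv_BijGroup[OF Bij[OF f]] by simp
    moreover have "homeomorphism {0..1} {0..1} (restrict g {0..1}) f"
      by (rule homeomorphism_cong[OF homeomorphism_symD[OF f(2)]]) auto
    ultimately show "inv\<^bsub>BijGroup {0..1}\<^esub> f \<in> carrier Homeo"
      by (auto simp: carrier_Homeo)
  next
    fix f f' assume "f \<in> carrier Homeo" "f' \<in> carrier Homeo"
    then obtain g g' where f: "f \<in> extensional {0..1}" "homeomorphism {0..1} {0..1} f g"
      and f': "f' \<in> extensional {0..1}" "homeomorphism {0..1} {0..1} f' g'"
      by (auto simp: carrier_Homeo)
    have "homeomorphism {0..1} {0..1} (f \<circ> f') (g' \<circ> g)"
      using f'(2) f(2) by (rule homeomorphism_compose)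
    then have "homeomorphism {0..1} {0..1} (compose {0..1} f f') (g' \<circ> g)"
      by (rule homeomorphism_cong) (auto simp: compose_def)
    then show "f \<otimes>\<^bsub>BijGroup {0..1}\<^esub> f' \<in> carrier Homeo"
      using Bij[OF f] Bij[OF f'] by (auto simp: carrier_Homeo BijGroup_def)
  qed
  then show ?thesis
    using B.subgroup_imp_group by (simp add: Homeo_def)
qed

lemma Metric_space_Homeo: "Metric_space (carrier Homeo) max_dist"
proof -
  have bdd: "bdd_above ((\<lambda>x. \<bar>f x - g x\<bar>) ` {0..1})"
    if "f \<in> carrier Homeo" "g \<in> carrier Homeo" for f g
  proof (rule bdd_aboveI2)
    fix x :: real assume "x \<in> {0..1}"
    then have "f x \<in> {0..1}" "g x \<in> {0..1}"
      using that by (auto simp: carrier_Homeo homeomorphism_def)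
    then show "\<bar>f x - g x\<bar> \<le> 1" by auto
  qed
  have upper: "\<bar>f x - g x\<bar> \<le> max_dist f g"
    if "f \<in> carrier Homeo" "g \<in> carrier Homeo" "x \<in> {0..1}" for f g x
    using cSUP_upper[OF that(3) bdd[OF that(1,2)]] that by (simp add: max_dist_def)
  show ?thesis
  proof
    fix f g
    show "0 \<le> max_dist f g"
    proof (cases "f \<in> carrier Homeo \<and> g \<in> carrier Homeo")
      case True
      then have "\<bar>f 0 - g 0\<bar> \<le> max_dist f g"
        by (intro upper) auto
      then show ?thesis
        by linarith
    qed (auto simp: max_dist_def)
    show "max_dist f g = max_dist g f"
      by (auto simp: max_dist_def abs_minus_commute)
  next
    fix f g assume fg: "f \<in> carrier Homeo" "g \<in> carrier Homeo"
    show "max_dist f g = 0 \<longleftrightarrow> f = g"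
    proof
      assume "max_dist f g = 0"
      then have "f x = g x" if "x \<in> {0..1}" for x
        using upper[OF fg that] by simp
      then show "f = g"
        using fg by (auto simp: carrier_Homeo intro: extensionalityI)
    qed (simp add: max_dist_def)
  next
    fix f g h assume fgh: "f \<in> carrier Homeo" "g \<in> carrier Homeo" "h \<in> carrier Homeo"
    have "(SUP x\<in>{0..1}. \<bar>f x - h x\<bar>) \<le> max_dist f g + max_dist g h"
    proof (rule cSUP_least)
      fix x :: real assume "x \<in> {0..1}"
      then show "\<bar>f x - h x\<bar> \<le> max_dist f g + max_dist g h"
        using upper[of f g x] upper[of g h x] fgh by linarith
    qed simp
    then show "max_dist f h \<le> max_dist f g + max_dist g h"
      using fgh by (simp add: max_dist_def)
  qed
qed

lemma topspace_Homeo_topology [simp]: "topspace Homeo_topology = carrier Homeo"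
  by (simp add: Homeo_topology_def Metric_space.topspace_mtopology[OF Metric_space_Homeo])


section \<open>Length of a graph\<close>

text \<open>The norm on \<open>real \<times> real\<close> is the Euclidean one.\<close>

definition graph_length :: "(real \<Rightarrow> real) \<Rightarrow> ennreal" where
  "graph_length f =
    (SUP (n, x) \<in> {(n :: nat, x :: nat \<Rightarrow> real).
        1 \<le> n \<and> x 0 = 0 \<and> x n = 1 \<and> (\<forall>i\<in>{1..n}. x (i - 1) < x i)}.
      ennreal (\<Sum>i=1..n. norm ((x i, f (x i)) - (x (i - 1), f (x (i - 1))))))"

end

(*
  A homeomorphism F of [0,1] is monotone, so its graph has length at most 2; the length is 2 if F is
  singular, i.e. if it maps the complement of some null set onto a null set. Fix one singular
  increasing homeomorphism s, the distribution function of a biased coin, and consider the random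
  homeomorphism

    f(x) = s (x powr exp b) powr exp (- a)    with (a, b) uniform in the unit square.

  For 0 < t < 1 the law of t powr exp b is absolutely continuous. Given homeomorphisms g and h,
  Fubini's theorem therefore shows that for almost every b, almost all x satisfy that
  h(x) powr exp b avoids the null set where s is not singular; likewise on the range side for almost
  every a. Hence g o f o h is singular almost surely. The set of homeomorphisms with graph length
  different from 2 is Borel because the length is lower semicontinuous.
*)

theory Submission
  imports Defs
begin

section \<open>A singular homeomorphism\<close>

text \<open>
  \<open>coin_weight n k\<close> is the probability that the first \<open>n\<close> binary digits of a random number are those
  of \<open>k / 2 ^ n\<close>, when each digit is \<open>1\<close> with probability \<open>3 / 4\<close>. For \<open>k \<ge> 2 ^ n\<close> the recursion
  continues this periodically, so that no upper bound on \<open>k\<close> is needed below.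
\<close>

fun coin_weight :: "nat \<Rightarrow> nat \<Rightarrow> real" where
  "coin_weight 0 k = 1"
| "coin_weight (Suc n) k = (if even k then 1 / 4 else 3 / 4) * coin_weight n (k div 2)"

definition coin_dist :: "nat \<Rightarrow> nat \<Rightarrow> real" where
  "coin_dist n k = (\<Sum>j<k. coin_weight n j)"

text \<open>\<open>coin_dist n k\<close> is the value at \<open>k / 2 ^ n\<close>. Taking the
  supremum over all grids at once avoids a limit in \<open>n\<close>. For \<open>x < 0\<close> the
  index set is empty, so the function is meaningful only for \<open>x \<ge> 0\<close>.\<close>

definition coin_cdf :: "real \<Rightarrow> real" where
  "coin_cdf x = (SUP (n, k) \<in> {(n, k). real k \<le> 2 ^ n * x}. coin_dist n k)"

section \<open>Compatibility of the weights on dyadic grids\<close>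

lemma sum_lessThan_double:
  fixes f :: "nat \<Rightarrow> 'a::comm_monoid_add"
  shows "(\<Sum>k<2 * m. f k) = (\<Sum>k<m. f (2 * k) + f (2 * k + 1))"
  by (induction m) (simp_all add: add.assoc)

lemma coin_weight_pos: "0 < coin_weight n k"
  by (induction n arbitrary: k) auto

lemma coin_weight_le: "coin_weight n k \<le> (3 / 4) ^ n"
proof (induction n arbitrary: k)
  case (Suc n)
  show ?case
    using Suc[of "k div 2"] coin_weight_pos[of n "k div 2"] by simp
qed simp

lemma coin_dist_Suc: "coin_dist n (Suc k) = coin_dist n k + coin_weight n k"
  by (simp add: coin_dist_def)

lemma coin_dist_mono: "k \<le> l \<Longrightarrow> coin_dist n k \<le> coin_dist n l"
  unfolding coin_dist_def by (intro sum_mono2) (auto simp: coin_weight_pos less_imp_le)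

text \<open>The two halves of a dyadic interval receive \<open>1 / 4\<close> and
  \<open>3 / 4\<close> of its weight, so refining the grid does not change the partial sums.\<close>

lemma coin_dist_refine: "coin_dist (n + m) (2 ^ m * k) = coin_dist n k"
proof (induction m)
  case (Suc m)
  have "coin_dist (Suc i) (2 * j) = coin_dist i j" for i j
    by (simp add: coin_dist_def sum_lessThan_double)
  from this[of "n + m" "2 ^ m * k"] show ?case
    using Suc by (simp add: mult.assoc)
qed simp

text \<open>Both \<open>k / 2 ^ n\<close> and \<open>l / 2 ^ m\<close> lie on the grid of level
  \<open>n + m\<close>, where their order is that of the indices. This sandwiches
  \<open>coin_cdf x\<close> between grid values on either side of \<open>x\<close>.\<close>

lemma coin_dist_le:
  assumes "real k \<le> 2 ^ n * x" "2 ^ m * x \<le> real l"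
  shows "coin_dist n k \<le> coin_dist m l"
proof -
  have "2 ^ m * real k \<le> 2 ^ m * (2 ^ n * x)"
    using assms(1) by (rule mult_left_mono) simp
  also have "\<dots> = 2 ^ n * (2 ^ m * x)"
    by simp
  also have "\<dots> \<le> 2 ^ n * real l"
    using assms(2) by (rule mult_left_mono) simp
  finally have "real (2 ^ m * k) \<le> real (2 ^ n * l)"
    by simp
  then have "coin_dist (n + m) (2 ^ m * k) \<le> coin_dist (m + n) (2 ^ n * l)"
    unfolding of_nat_le_iff add.commute[of m n] by (rule coin_dist_mono)
  then show ?thesis
    by (simp only: coin_dist_refine)
qed

lemma coin_dist_le_cdf:
  assumes "real k \<le> 2 ^ n * x"
  shows "coin_dist n k \<le> coin_cdf x"
proof -
  have "bdd_above ((\<lambda>(n, k). coin_dist n k) ` {(n, k). real k \<le> 2 ^ n * x})"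
    by (rule bdd_aboveI2[where M = "coin_dist 0 (nat \<lceil>x\<rceil>)"])
       (auto intro!: coin_dist_le[where x = x] simp: real_nat_ceiling_ge)
  from cSUP_upper[OF _ this, of "(n, k)"] show ?thesis
    using assms by (simp add: coin_cdf_def)
qed

lemma coin_cdf_le_dist:
  assumes "0 \<le> x" "2 ^ n * x \<le> real k"
  shows "coin_cdf x \<le> coin_dist n k"
  unfolding coin_cdf_def
proof (rule cSUP_least)
  show "{(n, k). real k \<le> 2 ^ n * x} \<noteq> {}"
    using assms(1) by (auto intro!: exI[of _ 0])
qed (use assms(2) in \<open>auto intro: coin_dist_le\<close>)

lemma coin_cdf_0: "coin_cdf 0 = 0"
  using coin_dist_le_cdf[of 0 0 0] coin_cdf_le_dist[of 0 0 0] by (simp add: coin_dist_def)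

lemma coin_cdf_1: "coin_cdf 1 = 1"
  using coin_dist_le_cdf[of 1 0 1] coin_cdf_le_dist[of 1 0 1] by (simp add: coin_dist_def)

section \<open>Strict monotonicity and continuity of the distribution function\<close>

lemma coin_cdf_strict_mono: "strict_mono_on {0..} coin_cdf"
proof (rule strict_mono_onI)
  fix x y :: real assume xy: "x \<in> {0..}" "y \<in> {0..}" "x < y"
  obtain n where "2 / (y - x) < 2 ^ n"
    using real_arch_pow[of 2 "2 / (y - x)"] by auto
  \<comment> \<open>On this grid a whole interval from \<open>k\<close> to \<open>k + 1\<close> fits
    between \<open>x\<close> and \<open>y\<close>; its positive weight makes the inequality
    strict.\<close>
  then have n: "2 ^ n * x + 2 < 2 ^ n * y"
    using xy by (simp add: divide_simps algebra_simps)
  define k where "k = nat \<lceil>2 ^ n * x\<rceil>"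
  have k: "2 ^ n * x \<le> real k" "real k < 2 ^ n * x + 1"
    using xy(1) by (auto simp: k_def of_nat_nat) linarith+
  have "coin_cdf x \<le> coin_dist n k"
    using xy k(1) by (intro coin_cdf_le_dist) auto
  also have "\<dots> < coin_dist n (Suc k)"
    by (simp add: coin_dist_Suc coin_weight_pos)
  also have "\<dots> \<le> coin_cdf y"
    using n k(2) by (intro coin_dist_le_cdf) simp
  finally show "coin_cdf x < coin_cdf y" .
qed

text \<open>Two adjacent grid intervals of level \<open>n\<close> cover \<open>{x..y}\<close>, and
  each has weight at most \<open>(3 / 4) ^ n\<close>.\<close>

lemma coin_cdf_modulus:
  assumes "0 \<le> x" "x \<le> y" "y \<le> x + 1 / 2 ^ n"
  shows "coin_cdf y \<le> coin_cdf x + 2 * (3 / 4) ^ n"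
proof -
  define k where "k = nat \<lfloor>2 ^ n * x\<rfloor>"
  have k: "real k \<le> 2 ^ n * x" "2 ^ n * x \<le> real k + 1"
    using assms(1) by (auto simp: k_def of_nat_nat)
  have "2 ^ n * y \<le> 2 ^ n * (x + 1 / 2 ^ n)"
    using assms(3) by (rule mult_left_mono) simp
  then have "2 ^ n * y \<le> real (Suc (Suc k))"
    using k(2) by (simp add: distrib_left)
  then have "coin_cdf y \<le> coin_dist n (Suc (Suc k))"
    using assms by (intro coin_cdf_le_dist) auto
  also have "\<dots> \<le> coin_dist n k + 2 * (3 / 4) ^ n"
    using coin_weight_le[of n k] coin_weight_le[of n "Suc k"] by (simp add: coin_dist_Suc)
  also have "\<dots> \<le> coin_cdf x + 2 * (3 / 4) ^ n"
    using coin_dist_le_cdf[OF k(1)] by simp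
  finally show ?thesis .
qed

lemma continuous_on_coin_cdf: "continuous_on {0..} coin_cdf"
  unfolding continuous_on_iff
proof (intro ballI allI impI)
  fix x e :: real assume x: "x \<in> {0..}" "0 < e"
  obtain n where "(3 / 4) ^ n < e / 2"
    using real_arch_pow_inv[of "e / 2" "3 / 4"] x by auto
  then have n: "2 * (3 / 4) ^ n < e"
    by simp
  show "\<exists>d>0. \<forall>y\<in>{0..}. dist y x < d \<longrightarrow> dist (coin_cdf y) (coin_cdf x) < e"
  proof (intro exI[of _ "1 / 2 ^ n"] conjI ballI impI)
    fix y :: real assume y: "y \<in> {0..}" "dist y x < 1 / 2 ^ n"
    have mono: "mono_on {0..} coin_cdf"
      using coin_cdf_strict_mono by (rule strict_mono_on_imp_mono_on)
    show "dist (coin_cdf y) (coin_cdf x) < e"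
      using coin_cdf_modulus[of x y n] coin_cdf_modulus[of y x n] n x y
        mono_onD[OF mono, of x y] mono_onD[OF mono, of y x]
      by (cases "x \<le> y") (auto simp: dist_real_def abs_if)
  qed simp
qed

lemma homeomorphism_coin_cdf: "\<exists>t. homeomorphism {0..1} {0..1} coin_cdf t"
proof (rule homeomorphism_compact)
  show cont: "continuous_on {0..1} coin_cdf"
    using continuous_on_coin_cdf by (rule continuous_on_subset) auto
  have sm: "strict_mono_on {0..1} coin_cdf"
    using coin_cdf_strict_mono by (auto simp: strict_mono_on_def)
  show "inj_on coin_cdf {0..1}"
    using sm by (rule strict_mono_on_imp_inj_on)
  have mono: "mono_on {0..1} coin_cdf"
    using sm by (rule strict_mono_on_imp_mono_on)
  show "coin_cdf ` {0..1} = {0..1}"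
  proof (intro equalityI subsetI)
    fix y assume "y \<in> coin_cdf ` {0..1}"
    then show "y \<in> {0..1}"
      using mono_onD[OF mono, of 0] mono_onD[OF mono, of _ 1] by (auto simp: coin_cdf_0 coin_cdf_1)
  next
    fix y :: real assume "y \<in> {0..1}"
    then show "y \<in> coin_cdf ` {0..1}"
      using IVT'[of coin_cdf 0 y 1] cont by (auto simp: coin_cdf_0 coin_cdf_1)
  qed
qed simp

section \<open>Singularity of the distribution function\<close>

text \<open>Weight and length are both products over the digits, so the sum of their geometric means
  factors. One digit contributes \<open>sqrt (1/4 * 1/2) + sqrt (3/4 * 1/2)\<close>, the Hellinger
  affinity of the biased and the fair coin, which is less than 1.\<close>

lemma sum_sqrt_coin_weight:
  "(\<Sum>k<2 ^ n. sqrt (coin_weight n k / 2 ^ n)) = (sqrt (1 / 8) + sqrt (3 / 8)) ^ n"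
proof (induction n)
  case (Suc n)
  have *: "sqrt (coin_weight (Suc n) (2 * k) / 2 ^ Suc n)
        + sqrt (coin_weight (Suc n) (2 * k + 1) / 2 ^ Suc n)
      = (sqrt (1 / 8) + sqrt (3 / 8)) * sqrt (coin_weight n k / 2 ^ n)" for k
    unfolding distrib_right real_sqrt_mult[symmetric] by simp
  show ?case
    unfolding power_Suc[of "2 :: nat" n] sum_lessThan_double * sum_distrib_left[symmetric] Suc
    by simp
qed simp

text \<open>The endpoints and the selection \<open>P\<close> are left open because the bound serves
  both the dyadic intervals and their images.\<close>

lemma measure_Union_dyadic_le:
  fixes a b :: "nat \<Rightarrow> real"
  assumes "\<And>k. a k \<le> b k" "\<And>k. P k \<Longrightarrow> b k - a k \<le> sqrt (coin_weight n k / 2 ^ n)"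
  shows "measure lborel (\<Union>k\<in>{k. k < 2 ^ n \<and> P k}. {a k..b k})
    \<le> (sqrt (1 / 8) + sqrt (3 / 8)) ^ n"
proof -
  have "measure lborel (\<Union>k\<in>{k. k < 2 ^ n \<and> P k}. {a k..b k})
      \<le> (\<Sum>k\<in>{k. k < 2 ^ n \<and> P k}. measure lborel {a k..b k})"
    by (intro measure_UNION_le) auto
  also have "\<dots> \<le> (\<Sum>k\<in>{k. k < 2 ^ n \<and> P k}. sqrt (coin_weight n k / 2 ^ n))"
    using assms by (intro sum_mono) auto
  also have "\<dots> \<le> (\<Sum>k<2 ^ n. sqrt (coin_weight n k / 2 ^ n))"
    by (intro sum_mono2) (auto simp: coin_weight_pos less_imp_le)
  finally show ?thesis
    by (simp only: sum_sqrt_coin_weight)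
qed

lemma limsup_dyadic_null:
  fixes a b :: "nat \<Rightarrow> nat \<Rightarrow> real"
  assumes "\<And>n k. a n k \<le> b n k" "\<And>n k. P n k \<Longrightarrow> b n k - a n k \<le> sqrt (coin_weight n k / 2 ^ n)"
  shows "limsup (\<lambda>n. \<Union>k\<in>{k. k < 2 ^ n \<and> P n k}. {a n k..b n k}) \<in> null_sets lborel"
proof (rule borel_cantelli_limsup1)
  fix n
  show "(\<Union>k\<in>{k. k < 2 ^ n \<and> P n k}. {a n k..b n k}) \<in> sets lborel"
    by (intro sets.finite_UN) auto
  have "bounded (\<Union>k\<in>{k. k < 2 ^ n \<and> P n k}. {a n k..b n k})"
    by (intro bounded_UN) auto
  then show "emeasure lborel (\<Union>k\<in>{k. k < 2 ^ n \<and> P n k}. {a n k..b n k}) < \<infinity>"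
    by (rule emeasure_bounded_finite)
next
  \<comment> \<open>The two rational bounds add up to \<open>49 / 50\<close>.\<close>
  have "sqrt (1 / 8) \<le> (9 / 25 :: real)" "sqrt (3 / 8) \<le> (31 / 50 :: real)"
    by (rule real_le_lsqrt; simp add: power2_eq_square)+
  then have "norm (sqrt (1 / 8) + sqrt (3 / 8) :: real) < 1"
    by simp
  then have "summable (\<lambda>n. (sqrt (1 / 8) + sqrt (3 / 8) :: real) ^ n)"
    by (rule summable_geometric)
  then show "summable (\<lambda>n. measure lborel (\<Union>k\<in>{k. k < 2 ^ n \<and> P n k}. {a n k..b n k}))"
    by (rule summable_comparison_test'[where N = 0])
       (use assms in \<open>auto intro: measure_Union_dyadic_le\<close>)
qed

text \<open>
  Either a dyadic interval or its image is shorter than the geometric mean of both lengths, and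
  these means add up to \<open>\<rho> ^ n\<close> with \<open>\<rho> < 1\<close>. So Borel--Cantelli applies on both sides.
\<close>

theorem coin_cdf_singular:
  obtains N1 N2 where "N1 \<in> null_sets lborel" "N2 \<in> null_sets lborel"
    "\<And>x. x \<in> {0..1} \<Longrightarrow> x \<in> N1 \<or> coin_cdf x \<in> N2"
proof
  \<comment> \<open>\<open>P\<close> selects the intervals whose image is longer than they are.
    These go into \<open>N1\<close>, and the images of the others into \<open>N2\<close>.\<close>
  define P where "P n k \<longleftrightarrow> 1 / 2 ^ n < coin_weight n k" for n k
  define N1 where "N1 = (\<lambda>n. \<Union>k\<in>{k. k < 2 ^ n \<and> P n k}. {real k / 2 ^ n..real (Suc k) / 2 ^ n})"
  define N2 where "N2 = (\<lambda>n. \<Union>k\<in>{k. k < 2 ^ n \<and> \<not> P n k}. {coin_dist n k..coin_dist n (Suc k)})"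
  have "1 / 2 ^ n \<le> sqrt (coin_weight n k / 2 ^ n)" if "P n k" for n k
    using that by (intro real_le_rsqrt) (simp add: P_def power2_eq_square divide_simps)
  then show "limsup N1 \<in> null_sets lborel"
    unfolding N1_def by (intro limsup_dyadic_null) (auto simp: divide_simps)
  have "coin_weight n k \<le> sqrt (coin_weight n k / 2 ^ n)" if "\<not> P n k" for n k
    using that coin_weight_pos[of n k]
    by (intro real_le_rsqrt) (simp add: P_def power2_eq_square divide_simps)
  then show "limsup N2 \<in> null_sets lborel"
    unfolding N2_def
    by (intro limsup_dyadic_null) (auto simp: coin_dist_Suc coin_weight_pos less_imp_le)
  fix x :: real assume x: "x \<in> {0..1}"
  have cover: "x \<in> N1 n \<or> coin_cdf x \<in> N2 n" for n
  proof -
    \<comment> \<open>At \<open>x = 1\<close> the floor would give \<open>2 ^ n\<close>, one index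
      too far, so the last interval is taken there.\<close>
    obtain k where k: "k < 2 ^ n" "real k \<le> 2 ^ n * x" "2 ^ n * x \<le> real (Suc k)"
    proof (cases "x = 1")
      case True
      then show ?thesis
        by (intro that[of "2 ^ n - 1"]) (auto simp: of_nat_diff)
    next
      case False
      then have "\<lfloor>2 ^ n * x\<rfloor> < 2 ^ n"
        using x by (simp add: floor_less_iff)
      then show ?thesis
        using x by (intro that[of "nat \<lfloor>2 ^ n * x\<rfloor>"]) (auto simp: nat_less_iff of_nat_nat, linarith)
    qed
    show ?thesis
    proof (cases "P n k")
      case True
      then show ?thesis
        using k by (auto simp: N1_def divide_simps mult.commute intro!: bexI[of _ k])
    next
      case False
      have "coin_cdf x \<in> {coin_dist n k..coin_dist n (Suc k)}"
        using k x by (simp add: coin_dist_le_cdf coin_cdf_le_dist)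
      then show ?thesis
        using False k(1) by (auto simp: N2_def)
    qed
  qed
  \<comment> \<open>If \<open>coin_cdf x\<close> lies in only finitely many \<open>N2 n\<close>,
    then \<open>cover\<close> puts \<open>x\<close> into all but finitely many
    \<open>N1 n\<close>.\<close>
  show "x \<in> limsup N1 \<or> coin_cdf x \<in> limsup N2"
    unfolding mem_limsup_iff
  proof (rule disjCI)
    assume "\<not> (\<exists>\<^sub>F n in sequentially. coin_cdf x \<in> N2 n)"
    then have "\<forall>\<^sub>F n in sequentially. coin_cdf x \<notin> N2 n"
      by (simp add: not_frequently)
    then have "\<forall>\<^sub>F n in sequentially. x \<in> N1 n"
      by eventually_elim (use cover in blast)
    then show "\<exists>\<^sub>F n in sequentially. x \<in> N1 n"
      by (intro eventually_frequently) auto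
  qed
qed

section \<open>Powers with random exponents\<close>

text \<open>The exponent is recovered from \<open>y = t powr exp b\<close> as
  \<open>b = ln (ln y / ln t)\<close>. This map is differentiable on \<open>{0<..<1}\<close>, so it
  sends null sets to null sets.\<close>

lemma AE_powr_exp_notin_null:
  fixes t :: real
  assumes N: "N \<in> null_sets lborel" and t: "0 < t" "t < 1"
  shows "AE b in lborel. t powr exp b \<notin> N"
proof -
  have "negligible N"
    using N by (simp add: negligible_iff_null_sets null_sets_completionI)
  then have "negligible (N \<inter> {0<..<1})"
    by (rule negligible_subset) auto
  moreover have "(\<lambda>y. ln (ln y / ln t)) differentiable_on (N \<inter> {0<..<1})"
  proof -
    have "(\<lambda>y. ln (ln y / ln t)) differentiable (at y)" if "y \<in> {0<..<1}" for y
      unfolding real_differentiable_def using that t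
      by (intro exI) (rule derivative_eq_intros refl | simp add: divide_neg_neg)+
    then show ?thesis
      by (auto simp: differentiable_on_def intro: differentiable_at_withinI)
  qed
  ultimately have "negligible ((\<lambda>y. ln (ln y / ln t)) ` (N \<inter> {0<..<1}))"
    by (rule negligible_differentiable_image_negligible[OF order_refl])
  \<comment> \<open>The image is only known to be Lebesgue null; \<open>N'\<close> is a Borel null
    set around it.\<close>
  then obtain N' where N': "N' \<in> null_sets lborel" "(\<lambda>y. ln (ln y / ln t)) ` (N \<inter> {0<..<1}) \<subseteq> N'"
    unfolding negligible_iff_null_sets null_sets_completion_iff2 by blast
  show ?thesis
  proof (rule AE_I'[OF N'(1)], rule subsetI)
    fix b assume "b \<in> {b \<in> space lborel. \<not> t powr exp b \<notin> N}"
    then have "t powr exp b \<in> N"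
      by simp
    moreover have "t powr exp b < 1"
      using t powr_less_mono'[of t 0 "exp b"] by simp
    moreover have "ln (ln (t powr exp b) / ln t) = b"
      using t by (simp add: ln_powr)
    ultimately show "b \<in> N'"
      using t N'(2) by (force simp: image_subset_iff)
  qed
qed

text \<open>The preceding lemma treats each fixed \<open>x\<close> with \<open>0 < k x < 1\<close>,
  and Fubini exchanges the quantifiers. Injectivity leaves only finitely many \<open>x\<close> with
  \<open>k x\<close> equal to 0 or 1, the points fixed by every power map.\<close>

lemma AE_AE_powr_exp_notin_null:
  fixes k :: "real \<Rightarrow> real"
  assumes N: "N \<in> null_sets lborel" and k: "continuous_on {0..1} k" "inj_on k {0..1}" "k \<in> {0..1} \<rightarrow> {0..1}"
  shows "AE b in lborel. AE x in lborel. x \<in> {0..1} \<longrightarrow> k x powr exp b \<notin> N"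
proof -
  have [measurable]: "N \<in> sets borel"
    using N by auto
  \<comment> \<open>Nothing is known of \<open>k\<close> outside \<open>{0..1}\<close>; cutting it
    off there gives a Borel function on the line, as joint measurability requires.\<close>
  have [measurable]: "(\<lambda>x. k x * indicator {0..1} x) \<in> borel_measurable borel"
    using borel_measurable_continuous_on_indicator[of "{0..1}" k] k(1) by (simp add: mult.commute)
  have *: "(x \<in> {0..1} \<longrightarrow> k x powr exp b \<notin> N) \<longleftrightarrow>
      (x \<in> {0..1} \<longrightarrow> (k x * indicator {0..1} x) powr exp b \<notin> N)" for x b :: real
    by auto
  have "finite {x \<in> {0..1}. k x \<in> {0, 1}}"
    using finite_vimage_IntI[OF _ k(2), of "{0, 1}"] by (auto simp: vimage_def Int_def conj_commute)
  then have "AE x in lborel. x \<notin> {x \<in> {0..1}. k x \<in> {0, 1}}"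
    by (intro AE_not_in) (auto simp: null_sets_def emeasure_lborel_countable countable_finite borel_closed finite_imp_closed)
  then have "AE x in lborel. AE b in lborel. x \<in> {0..1} \<longrightarrow> k x powr exp b \<notin> N"
  proof eventually_elim
    case (elim x)
    show ?case
    proof (rule AE_impI)
      assume "x \<in> {0..1}"
      with elim k(3) have "0 < k x" "k x < 1"
        by (force simp: Pi_iff less_le)+
      then show "AE b in lborel. k x powr exp b \<notin> N"
        using N by (rule AE_powr_exp_notin_null[rotated])
    qed
  qed
  then show ?thesis
    unfolding * by (subst lborel_pair.AE_commute) measurable
qed

section \<open>Length of graphs of homeomorphisms\<close>

lemma partition_mono:
  fixes x :: "nat \<Rightarrow> real"
  assumes "i \<le> j" "j \<le> n" "\<forall>i\<in>{1..n}. x (i - 1) < x i"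
  shows "x i \<le> x j"
  using assms
proof (induction j)
  case (Suc j)
  then show ?case
    using Suc.prems(3)[rule_format, of "Suc j"] by (cases "i = Suc j") auto
qed simp

text \<open>A homeomorphism may reverse the orientation; the sign \<open>\<sigma>\<close> allows
  both cases to be handled at once.\<close>

lemma abs_diff_mono_or_antimono:
  fixes F :: "real \<Rightarrow> real"
  assumes "strict_mono_on {0..1} F \<or> strict_antimono_on {0..1} F"
  obtains \<sigma> :: real where "\<sigma> = 1 \<or> \<sigma> = - 1"
    "\<And>x y. 0 \<le> x \<Longrightarrow> x \<le> y \<Longrightarrow> y \<le> 1 \<Longrightarrow> \<bar>F y - F x\<bar> = \<sigma> * (F y - F x)"
  using assms
proof
  assume "strict_mono_on {0..1} F"
  then have "mono_on {0..1} F"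
    by (rule strict_mono_on_imp_mono_on)
  then show ?thesis
    by (intro that[of 1]) (auto simp: mono_onD)
next
  assume *: "strict_antimono_on {0..1} F"
  have "F y \<le> F x" if "0 \<le> x" "x \<le> y" "y \<le> 1" for x y
    using monotone_onD[OF *, of x y] that by (cases "x = y") auto
  then show ?thesis
    by (intro that[of "-1"]) auto
qed

lemma homeomorphism_strict_monotone:
  fixes F :: "real \<Rightarrow> real"
  assumes "homeomorphism {0..1} {0..1} F G"
  shows "strict_mono_on {0..1} F \<or> strict_antimono_on {0..1} F"
proof -
  have "continuous_on {0..1} F" "inj_on F {0..1}"
    using assms by (auto simp: homeomorphism_def intro: inj_on_inverseI)
  then show ?thesis
    using injective_eq_monotone_map[of "{0..1}" F] by (simp add: is_interval_cc)
qed

text \<open>Each segment is at most the sum of its legs. By monotonicity the horizontal and the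
  vertical legs both telescope, to at most 1 each.\<close>

lemma graph_length_le_2:
  assumes F: "homeomorphism {0..1} {0..1} F G"
  shows "graph_length F \<le> 2"
  unfolding graph_length_def
proof (rule SUP_least, safe)
  fix n :: nat and x :: "nat \<Rightarrow> real"
  assume n: "1 \<le> n" and x: "x 0 = 0" "x n = 1" "\<forall>i\<in>{1..n}. x (i - 1) < x i"
  have mono: "x i \<le> x j" if "i \<le> j" "j \<le> n" for i j
    using that x(3) by (rule partition_mono)
  obtain \<sigma> :: real where \<sigma>: "\<sigma> = 1 \<or> \<sigma> = - 1"
    "\<And>x y. 0 \<le> x \<Longrightarrow> x \<le> y \<Longrightarrow> y \<le> 1 \<Longrightarrow> \<bar>F y - F x\<bar> = \<sigma> * (F y - F x)"
    using abs_diff_mono_or_antimono[OF homeomorphism_strict_monotone[OF F]] by blast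
  have F01: "F 0 \<in> {0..1}" "F 1 \<in> {0..1}"
    using F by (auto simp: homeomorphism_def)
  have "(\<Sum>i=1..n. norm ((x i, F (x i)) - (x (i - 1), F (x (i - 1)))))
      \<le> (\<Sum>i=1..n. (x i - x (i - 1)) + \<sigma> * (F (x i) - F (x (i - 1))))"
  proof (rule sum_mono)
    fix i assume i: "i \<in> {1..n}"
    have "0 \<le> x (i - 1)" "x (i - 1) \<le> x i" "x i \<le> 1"
      using mono[of 0 "i - 1"] mono[of "i - 1" i] mono[of i n] i x by auto
    then show "norm ((x i, F (x i)) - (x (i - 1), F (x (i - 1))))
        \<le> (x i - x (i - 1)) + \<sigma> * (F (x i) - F (x (i - 1)))"
      using norm_Pair_le[of "x i - x (i - 1)" "F (x i) - F (x (i - 1))"] \<sigma>(2) by simp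
  qed
  also have "\<dots> = (\<Sum>i<n. x (Suc i) - x i) + \<sigma> * (\<Sum>i<n. F (x (Suc i)) - F (x i))"
    by (simp add: sum.distrib sum_distrib_left sum.atLeast1_atMost_eq)
  also have "\<dots> = (x n - x 0) + \<sigma> * (F (x n) - F (x 0))"
    by (simp only: sum_lessThan_telescope[of x] sum_lessThan_telescope[of "\<lambda>i. F (x i)"])
  also have "\<dots> \<le> 2"
    using x \<sigma>(1) F01 by auto
  finally show "ennreal (\<Sum>i=1..n. norm ((x i, F (x i)) - (x (i - 1), F (x (i - 1))))) \<le> 2"
    by (simp add: ennreal_le_iff[of 2, simplified])
qed

section \<open>Lower bound for the length of singular graphs\<close>

lemma grid_interval_subset:
  assumes "i \<in> {1..n}"
  shows "{real (i - 1) / n..real i / n} \<subseteq> {0..1}"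
proof -
  have "0 \<le> real (i - 1) / n" "real i / n \<le> 1"
    using assms by (auto simp: divide_simps)
  then show ?thesis
    by (auto intro: order_trans)
qed

text \<open>
  Since a segment of the graph is at least as long as either of its two legs, intervals of small
  total length whose images have almost full measure make the graph almost as long as possible.
\<close>

lemma graph_length_ge:
  assumes F: "homeomorphism {0..1} {0..1} F G"
    and I: "I \<subseteq> {1..n}" and n: "1 \<le> n"
    and a: "c \<le> measure lborel (\<Union>i\<in>I. F ` {real (i - 1) / n..real i / n})"
  shows "ennreal (1 - card I / n + c) \<le> graph_length F"
proof -
  define x where "x i = real i / n" for i
  have cont: "continuous_on {0..1} F"
    using F by (auto simp: homeomorphism_def)
  obtain \<sigma> :: real where \<sigma>: "\<sigma> = 1 \<or> \<sigma> = - 1"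
    "\<And>x y. 0 \<le> x \<Longrightarrow> x \<le> y \<Longrightarrow> y \<le> 1 \<Longrightarrow> \<bar>F y - F x\<bar> = \<sigma> * (F y - F x)"
    using abs_diff_mono_or_antimono[OF homeomorphism_strict_monotone[OF F]] by blast
  let ?L = "\<lambda>i. norm ((x i, F (x i)) - (x (i - 1), F (x (i - 1))))"
  have step: "0 \<le> x (i - 1)" "x i - x (i - 1) = 1 / n" "x i \<le> 1" if "i \<in> {1..n}" for i
    using that n by (auto simp: x_def divide_simps of_nat_diff)
  have "finite I"
    using I finite_subset by blast
  have sets: "F ` {x (i - 1)..x i} \<in> sets lborel" if "i \<in> {1..n}" for i
  proof -
    have "compact (F ` {x (i - 1)..x i})"
      using grid_interval_subset[OF that]
      by (intro compact_continuous_image continuous_on_subset[OF cont]) (auto simp: x_def)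
    then show ?thesis
      by (simp add: borel_compact)
  qed
  have meas: "measure lborel (F ` {x (i - 1)..x i}) \<le> \<bar>F (x i) - F (x (i - 1))\<bar>" if i: "i \<in> {1..n}" for i
  proof -
    have le: "x (i - 1) \<le> x i"
      using step(2)[OF i] by (smt (verit) divide_nonneg_nonneg of_nat_0_le_iff)
    have "F ` {x (i - 1)..x i} \<subseteq> {min (F (x (i - 1))) (F (x i))..max (F (x (i - 1))) (F (x i))}"
    proof (rule image_subsetI)
      fix y assume y: "y \<in> {x (i - 1)..x i}"
      then show "F y \<in> {min (F (x (i - 1))) (F (x i))..max (F (x (i - 1))) (F (x i))}"
        using \<sigma>(2)[of "x (i - 1)" y] \<sigma>(2)[of y "x i"] step[OF i] \<sigma>(1) by auto
    qed
    then have "measure lborel (F ` {x (i - 1)..x i})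
        \<le> measure lborel {min (F (x (i - 1))) (F (x i))..max (F (x (i - 1))) (F (x i))}"
      by (rule measure_mono_fmeasurable) (use sets[OF i] in \<open>simp_all add: fmeasurable_compact\<close>)
    then show ?thesis
      by (auto simp: max_def min_def split: if_splits)
  qed
  \<comment> \<open>Over \<open>I\<close> the vertical legs are counted, since they bound the
    measure of the images; over the remaining cells the horizontal legs.\<close>
  have "c \<le> measure lborel (\<Union>i\<in>I. F ` {x (i - 1)..x i})"
    using a by (simp add: x_def)
  also have "\<dots> \<le> (\<Sum>i\<in>I. measure lborel (F ` {x (i - 1)..x i}))"
    using sets I \<open>finite I\<close> by (intro measure_UNION_le) auto
  also have "\<dots> \<le> (\<Sum>i\<in>I. ?L i)"
  proof (rule sum_mono)
    fix i assume "i \<in> I"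
    then have "measure lborel (F ` {x (i - 1)..x i}) \<le> \<bar>F (x i) - F (x (i - 1))\<bar>"
      using I by (intro meas) auto
    also have "\<dots> \<le> ?L i"
      using norm_snd_le[of "F (x i) - F (x (i - 1))" "x i - x (i - 1)"] by simp
    finally show "measure lborel (F ` {x (i - 1)..x i}) \<le> ?L i" .
  qed
  finally have 1: "c \<le> (\<Sum>i\<in>I. ?L i)" .
  have "1 - card I / n = (\<Sum>i\<in>{1..n} - I. 1 / n)"
    using I \<open>finite I\<close> n card_mono[OF _ I] by (simp add: card_Diff_subset of_nat_diff divide_simps)
  also have "\<dots> \<le> (\<Sum>i\<in>{1..n} - I. ?L i)"
  proof (rule sum_mono)
    fix i assume "i \<in> {1..n} - I"
    then have "1 / n = \<bar>x i - x (i - 1)\<bar>"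
      using step[of i] by simp
    also have "\<dots> \<le> ?L i"
      using norm_fst_le[of "x i - x (i - 1)" "F (x i) - F (x (i - 1))"] by simp
    finally show "1 / n \<le> ?L i" .
  qed
  finally have "1 - card I / n + c \<le> (\<Sum>i\<in>{1..n} - I. ?L i) + (\<Sum>i\<in>I. ?L i)"
    using 1 by linarith
  also have "\<dots> = (\<Sum>i=1..n. ?L i)"
    by (rule sum.subset_diff[OF I, symmetric]) simp
  finally have "ennreal (1 - card I / n + c) \<le> ennreal (\<Sum>i=1..n. ?L i)"
    by (rule ennreal_leI)
  also have "\<dots> \<le> graph_length F"
    unfolding graph_length_def
    using n by (intro SUP_upper2[where i = "(n, x)"]) (auto simp: x_def divide_strict_right_mono)
  finally show ?thesis .
qed

text \<open>Half-open cells are disjoint. Index 0 is excluded because truncated subtraction makes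
  its cell empty.\<close>

lemma measure_Union_grid:
  assumes I: "finite I" "0 \<notin> I" and n: "1 \<le> (n::nat)"
  shows "measure lborel (\<Union>i\<in>I. {real (i - 1) / n..<real i / n}) = card I / n"
proof -
  have "measure lborel (\<Union>i\<in>I. {real (i - 1) / n..<real i / n})
      = (\<Sum>i\<in>I. measure lborel {real (i - 1) / n..<real i / n})"
  proof (rule measure_finite_Union[OF I(1)])
    have "i = j" if "i \<in> I" "j \<in> I"
      "y \<in> {real (i - 1) / n..<real i / n}" "y \<in> {real (j - 1) / n..<real j / n}" for i j y
    proof -
      have "i \<noteq> 0" "j \<noteq> 0"
        using that(1,2) I(2) by metis+
      moreover have "real (i - 1) / n < real j / n" "real (j - 1) / n < real i / n"
        using that(3,4) by (auto intro: le_less_trans)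
      then have "real (i - 1) < real j" "real (j - 1) < real i"
        using n by (simp_all add: divide_less_cancel)
      ultimately show "i = j"
        by (simp only: of_nat_less_iff)
    qed
    then show "disjoint_family_on (\<lambda>i. {real (i - 1) / n..<real i / n}) I"
      unfolding disjoint_family_on_def by blast
  next
    show "emeasure lborel {real (i - 1) / n..<real i / n} \<noteq> \<infinity>" for i
      by (cases "real (i - 1) / n \<le> real i / n") auto
  qed auto
  also have "\<dots> = (\<Sum>i\<in>I. 1 / n)"
  proof (rule sum.cong)
    fix i assume "i \<in> I"
    then have "i \<noteq> 0"
      using I(2) by metis
    then show "measure lborel {real (i - 1) / n..<real i / n} = 1 / n"
      by (simp add: divide_right_mono diff_divide_distrib[symmetric] of_nat_diff)
  qed simp
  finally show ?thesis
    by simp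
qed

text \<open>Cover \<open>N1\<close> by an open \<open>U\<close> of measure below \<open>e\<close>.
  The dyadic cells inside \<open>U\<close> exhaust \<open>U\<close> in \<open>{0..1}\<close>, so
  their images exhaust \<open>{0..1}\<close> up to \<open>N2\<close>. On a fine grid they have total
  length at most \<open>e\<close> but images of measure at least \<open>1 - e\<close>, and
  \<open>graph_length_ge\<close> yields \<open>2 - 2 * e\<close>.\<close>

lemma graph_length_eq_2_if_singular:
  assumes F: "homeomorphism {0..1} {0..1} F G"
    and N: "N1 \<in> null_sets lborel" "N2 \<in> null_sets lborel"
    and cover: "\<And>x. x \<in> {0..1} \<Longrightarrow> x \<in> N1 \<or> F x \<in> N2"
  shows "graph_length F = 2"
proof (rule antisym[OF graph_length_le_2[OF F]])
  have cont: "continuous_on {0..1} F" and im: "F ` {0..1} = {0..1}"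
    using F by (auto simp: homeomorphism_def)
  have *: "ennreal (2 - 2 * e) \<le> graph_length F" if "0 < e" for e
  proof -
    obtain U where U: "open U" "N1 \<subseteq> U" "emeasure lborel (U - N1) < ennreal e"
      using outer_regular_lborel[of N1 e] N(1) \<open>0 < e\<close> by (metis null_setsD2 sets_lborel)
    have Ue: "emeasure lborel U < ennreal e"
      using U N(1) by (simp add: emeasure_Diff_null_set)
    define J where "J m = {i \<in> {1..2 ^ m}. {real (i - 1) / 2 ^ m..real i / 2 ^ m} \<subseteq> U}" for m :: nat
    define D where "D m = (\<Union>i\<in>J m. {real (i - 1) / 2 ^ m..real i / 2 ^ m})" for m :: nat
    have J: "finite (J m)" "0 \<notin> J m" "J m \<subseteq> {1..2 ^ m}" for m
      by (auto simp: J_def)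
    have D01: "D m \<subseteq> {0..1}" for m
      unfolding D_def
    proof (rule UN_least)
      fix i assume "i \<in> J m"
      then show "{real (i - 1) / 2 ^ m..real i / 2 ^ m} \<subseteq> {0..1}"
        using grid_interval_subset[of i "2 ^ m"] by (simp add: J_def)
    qed
    have "F ` D m \<in> sets lborel" for m
    proof -
      have "compact (D m)"
        unfolding D_def using J by (intro compact_UN) auto
      then have "compact (F ` D m)"
        by (intro compact_continuous_image continuous_on_subset[OF cont] D01)
      then show ?thesis
        by (simp add: borel_compact)
    qed
    then have sets: "range (\<lambda>m. F ` D m) \<subseteq> sets lborel"
      by auto
    have "D m \<subseteq> D (Suc m)" for m
    proof
      fix x assume "x \<in> D m"
      then obtain i where i: "i \<in> J m" "x \<in> {real (i - 1) / 2 ^ m..real i / 2 ^ m}"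
        by (auto simp: D_def)
      \<comment> \<open>Cell \<open>i\<close> splits into the cells \<open>2 * i - 1\<close> and
        \<open>2 * i\<close> of the next level; \<open>j\<close> is one that contains
        \<open>x\<close>.\<close>
      define j where "j = (if 2 ^ Suc m * x \<le> real (2 * i - 1) then 2 * i - 1 else 2 * i)"
      have "1 \<le> i" "i \<le> 2 ^ m"
        using i(1) by (auto simp: J_def)
      then have x: "x \<in> {real (j - 1) / 2 ^ Suc m..real j / 2 ^ Suc m}" and "j \<in> {1..2 ^ Suc m}"
        "{real (j - 1) / 2 ^ Suc m..real j / 2 ^ Suc m} \<subseteq> {real (i - 1) / 2 ^ m..real i / 2 ^ m}"
        using i(2) by (auto simp: j_def divide_simps of_nat_diff algebra_simps)
      then have "j \<in> J (Suc m)"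
        using i(1) unfolding J_def by blast
      with x show "x \<in> D (Suc m)"
        unfolding D_def by blast
    qed
    then have inc: "incseq (\<lambda>m. F ` D m)"
      by (intro incseq_SucI image_mono)
    have UD: "{0..1} \<inter> U \<subseteq> (\<Union>m. D m)"
    proof
      fix x assume x: "x \<in> {0..1} \<inter> U"
      then obtain r where r: "0 < r" "cball x r \<subseteq> U"
        using U(1) open_contains_cball by blast
      obtain m where m: "(1 / 2) ^ m < r"
        using real_arch_pow_inv[of r "1 / 2"] r(1) by auto
      \<comment> \<open>The maximum with 1 provides for \<open>x = 0\<close>, where the ceiling is
        0.\<close>
      define i where "i = max 1 (nat \<lceil>2 ^ m * x\<rceil>)"
      have "\<lceil>2 ^ m * x\<rceil> \<le> 2 ^ m"
        using x by (simp add: ceiling_le_iff)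
      then have i1: "i \<in> {1..2 ^ m}"
        by (simp add: i_def nat_le_iff)
      have "real i = 1 \<and> 2 ^ m * x \<le> 1 \<or> real i = of_int \<lceil>2 ^ m * x\<rceil>"
      proof (cases "\<lceil>2 ^ m * x\<rceil> \<le> 1")
        case True
        then show ?thesis
          by (simp add: i_def ceiling_le_iff max_def) linarith
      next
        case False
        then have "1 \<le> nat \<lceil>2 ^ m * x\<rceil>"
          by linarith
        then show ?thesis
          using False by (simp add: i_def max_def)
      qed
      then have i2: "real (i - 1) \<le> 2 ^ m * x" "2 ^ m * x \<le> real i"
        using x i1 by (auto simp: of_nat_diff)
      have "{real (i - 1) / 2 ^ m..real i / 2 ^ m} \<subseteq> cball x ((1 / 2) ^ m)"
        using i1 i2 by (auto simp: dist_real_def abs_le_iff of_nat_diff field_simps)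
      also have "\<dots> \<subseteq> U"
        using m r(2) by (intro order_trans[OF subset_cball r(2)]) simp
      finally have "i \<in> J m"
        using i1 by (simp add: J_def)
      moreover have "x \<in> {real (i - 1) / 2 ^ m..real i / 2 ^ m}"
        using i2 by (simp add: divide_simps mult.commute)
      ultimately show "x \<in> (\<Union>m. D m)"
        by (auto simp: D_def)
    qed
    have "{0..1} - N2 \<subseteq> (\<Union>m. F ` D m)"
    proof (intro subsetI)
      fix y assume y: "y \<in> {0..1} - N2"
      then obtain x where x: "x \<in> {0..1}" "y = F x"
        using im by (metis DiffD1 imageE)
      then have "x \<in> {0..1} \<inter> U"
        using cover[OF x(1)] U(2) y by auto
      with UD x(2) show "y \<in> (\<Union>m. F ` D m)"
        by blast
    qed
    then have "emeasure lborel ({0..1} - N2) \<le> emeasure lborel (\<Union>m. F ` D m)"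
      using sets by (intro emeasure_mono) auto
    then have "1 \<le> emeasure lborel (\<Union>m. F ` D m)"
      using N(2) by (simp add: emeasure_Diff_null_set)
    moreover have "ennreal (1 - e) < 1"
      using \<open>0 < e\<close> by (simp add: ennreal_less_one_iff)
    ultimately have "ennreal (1 - e) < emeasure lborel (\<Union>m. F ` D m)"
      by (rule less_le_trans[rotated])
    from order_tendstoD(1)[OF Lim_emeasure_incseq[OF sets inc] this]
    obtain m where m: "ennreal (1 - e) < emeasure lborel (F ` D m)"
      by (auto simp: eventually_sequentially)
    have fin: "emeasure lborel (F ` D m) < \<infinity>"
      using D01[of m] im by (intro emeasure_bounded_finite bounded_subset[OF bounded_closed_interval[of 0 1]]) auto
    have "1 - e \<le> measure lborel (F ` D m)"
      using m fin ennreal_leI[of "measure lborel (F ` D m)" "1 - e"]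
      by (fastforce simp: emeasure_eq_ennreal_measure simp flip: not_le)
    then have "1 - e \<le> measure lborel (\<Union>i\<in>J m. F ` {real (i - 1) / real (2 ^ m)..real i / real (2 ^ m)})"
      by (simp add: D_def image_UN)
    from graph_length_ge[OF F J(3) _ this]
    have "ennreal (1 - card (J m) / 2 ^ m + (1 - e)) \<le> graph_length F"
      by simp
    moreover have "card (J m) / 2 ^ m \<le> e"
    proof -
      \<comment> \<open>Adjacent closed cells share endpoints, so the cells are counted through
        their half-open versions.\<close>
      have "(\<Union>i\<in>J m. {real (i - 1) / real (2 ^ m)..<real i / real (2 ^ m)}) \<subseteq> U"
        by (auto simp: J_def subset_iff)
      then have "measure lborel (\<Union>i\<in>J m. {real (i - 1) / real (2 ^ m)..<real i / real (2 ^ m)}) \<le> measure lborel U"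
        using Ue U(1) J by (intro measure_mono_fmeasurable) (auto simp: fmeasurable_def intro: less_trans)
      then have "card (J m) / 2 ^ m \<le> measure lborel U"
        using measure_Union_grid[OF J(1,2), of "2 ^ m"] by simp
      also have "\<dots> \<le> e"
        using Ue \<open>0 < e\<close> by (simp add: measure_def enn2real_leI)
      finally show ?thesis .
    qed
    then have "ennreal (2 - 2 * e) \<le> ennreal (1 - card (J m) / 2 ^ m + (1 - e))"
      by (intro ennreal_leI) simp
    ultimately show ?thesis
      by (rule order_trans[rotated])
  qed
  show "2 \<le> graph_length F"
  proof (rule LIMSEQ_le_const2)
    have "(\<lambda>k. ennreal (2 - 2 * inverse (real (Suc k)))) \<longlonglongrightarrow> ennreal (2 - 2 * 0)"
      by (intro tendsto_ennrealI tendsto_intros LIMSEQ_inverse_real_of_nat)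
    then show "(\<lambda>k. ennreal (2 - 2 * inverse (real (Suc k)))) \<longlonglongrightarrow> 2"
      by simp
  qed (use * in auto)
qed

section \<open>Borel sets of homeomorphisms\<close>

interpretation Homeo: Metric_space "carrier Homeo" max_dist
  by (rule Metric_space_Homeo)

lemma Homeo_into_unit: "f \<in> carrier Homeo \<Longrightarrow> x \<in> {0..1} \<Longrightarrow> f x \<in> {0..1}"
  by (auto simp: carrier_Homeo homeomorphism_def)

lemma abs_diff_le_max_dist:
  assumes "f \<in> carrier Homeo" "g \<in> carrier Homeo" "x \<in> {0..1}"
  shows "\<bar>f x - g x\<bar> \<le> max_dist f g"
proof -
  have "bdd_above ((\<lambda>x. \<bar>f x - g x\<bar>) ` {0..1})"
  proof (rule bdd_aboveI2)
    fix x :: real assume "x \<in> {0..1}"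
    then show "\<bar>f x - g x\<bar> \<le> 1"
      using Homeo_into_unit[OF assms(1), of x] Homeo_into_unit[OF assms(2), of x] by auto
  qed
  from cSUP_upper[OF assms(3) this] show ?thesis
    using assms(1,2) by (simp add: max_dist_def)
qed

text \<open>The condition \<open>0 \<le> r\<close> covers the value 0 of \<open>max_dist\<close>
  outside the carrier.\<close>

lemma max_dist_leI:
  assumes "0 \<le> r" "\<And>x. x \<in> {0..1} \<Longrightarrow> \<bar>f x - g x\<bar> \<le> r"
  shows "max_dist f g \<le> r"
  using assms by (auto simp: max_dist_def intro!: cSUP_least)

text \<open>This is lower semicontinuity: a partition that witnesses length above \<open>c\<close>
  for \<open>f\<close> does so for all nearby \<open>g\<close>.\<close>

lemma openin_graph_length_gt: "openin Homeo_topology {f \<in> carrier Homeo. c < graph_length f}"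
  unfolding Homeo_topology_def Homeo.openin_mtopology
proof (intro conjI allI impI)
  fix f assume f: "f \<in> {f \<in> carrier Homeo. c < graph_length f}"
  let ?L = "\<lambda>f (x :: nat \<Rightarrow> real) i. norm ((x i, f (x i)) - (x (i - 1), f (x (i - 1)) :: real))"
  from f obtain n x where x: "1 \<le> n" "x 0 = 0" "x n = 1" "\<forall>i\<in>{1..n}. x (i - 1) < x i"
    and c: "c < ennreal (\<Sum>i=1..n. ?L f x i)"
    by (auto simp: graph_length_def less_SUP_iff)
  have "c \<noteq> \<infinity>"
    using c by auto
  then obtain c' where c': "c = ennreal c'" "0 \<le> c'"
    by (cases c) auto
  define S where "S = (\<Sum>i=1..n. ?L f x i)"
  have "c' < S"
    using c c' by (simp add: S_def ennreal_less_iff)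
  \<comment> \<open>Each of the \<open>n\<close> segments changes by less than \<open>2 * r\<close>,
    so the whole sum loses less than \<open>S - c'\<close>.\<close>
  define r where "r = (S - c') / (2 * n)"
  have r: "0 < r" "2 * n * r = S - c'"
    using \<open>c' < S\<close> x(1) by (auto simp: r_def)
  have mono: "x i \<le> x j" if "i \<le> j" "j \<le> n" for i j
    using that x(4) by (rule partition_mono)
  have "g \<in> {f \<in> carrier Homeo. c < graph_length f}" if g: "g \<in> Homeo.mball f r" for g
  proof -
    have gG: "g \<in> carrier Homeo" and d: "max_dist f g < r"
      using g by auto
    have close: "\<bar>f (x i) - g (x i)\<bar> < r" if "i \<le> n" for i
      using abs_diff_le_max_dist[of f g "x i"] f gG d mono[of 0 i] mono[of i n] that x by auto
    have "?L f x i - ?L g x i < 2 * r" if i: "i \<in> {1..n}" for i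
    proof -
      have "?L f x i - ?L g x i \<le> 
          norm (((x i, f (x i)) - (x (i - 1), f (x (i - 1))))
            - ((x i, g (x i)) - (x (i - 1), g (x (i - 1)))))"
        by (rule norm_triangle_ineq2)
      also have "\<dots> = \<bar>(f (x i) - g (x i)) - (f (x (i - 1)) - g (x (i - 1)))\<bar>"
        by (simp add: norm_Pair algebra_simps)
      also have "\<dots> < 2 * r"
        using close[of i] close[of "i - 1"] i by (smt (verit) atLeastAtMost_iff diff_le_self le_trans)
      finally show ?thesis .
    qed
    then have "(\<Sum>i=1..n. ?L f x i - ?L g x i) < (\<Sum>i=1..n. 2 * r)"
      using x(1) by (intro sum_strict_mono) auto
    then have "c' < (\<Sum>i=1..n. ?L g x i)"
      using r(2) by (simp add: sum_subtractf S_def)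
    then have "c < ennreal (\<Sum>i=1..n. ?L g x i)"
      using c' by (simp add: ennreal_less_iff)
    also have "\<dots> \<le> graph_length g"
      unfolding graph_length_def using x by (intro SUP_upper2[where i = "(n, x)"]) auto
    finally show ?thesis
      using gG by simp
  qed
  then show "\<exists>r>0. Homeo.mball f r \<subseteq> {f \<in> carrier Homeo. c < graph_length f}"
    using r(1) by blast
qed auto

lemma space_borel_of [simp]: "space (borel_of T) = topspace T"
  by (auto simp: borel_of_def space_measure_of_conv)

lemma sets_borel_of: "sets (borel_of T) = sigma_sets (topspace T) {U. openin T U}"
  unfolding borel_of_def by (rule sets_measure_of) (auto dest: openin_subset)

lemma openin_borel_of: "openin T U \<Longrightarrow> U \<in> sets (borel_of T)"
  by (auto simp: sets_borel_of)

text \<open>Semicontinuity makes the sets of lengths above a bound open; length at least 2 is a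
  countable intersection of such sets.\<close>

lemma borel_graph_length_neq_2:
  "{f \<in> carrier Homeo. graph_length f \<noteq> 2} \<in> sets (borel_of Homeo_topology)"
proof -
  have 2: "ennreal (2 - inverse (Suc k)) < 2" for k
    using ennreal_less_iff[of "2 - inverse (Suc k)" 2] by (simp add: divide_simps)
  have *: "2 \<le> graph_length f" if "\<And>k. ennreal (2 - inverse (Suc k)) < graph_length f" for f
  proof (rule LIMSEQ_le_const2)
    have "(\<lambda>k. ennreal (2 - inverse (real (Suc k)))) \<longlonglongrightarrow> ennreal (2 - 0)"
      by (intro tendsto_ennrealI tendsto_intros LIMSEQ_inverse_real_of_nat)
    then show "(\<lambda>k. ennreal (2 - inverse (real (Suc k)))) \<longlonglongrightarrow> 2"
      by simp
  qed (use that less_imp_le in blast)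
  let ?A = "\<lambda>c. {f \<in> carrier Homeo. c < graph_length f}"
  have "?A c \<in> sets (borel_of Homeo_topology)" for c
    by (intro openin_borel_of openin_graph_length_gt)
  moreover have "carrier Homeo \<in> sets (borel_of Homeo_topology)"
    using sets.top[of "borel_of Homeo_topology"] by simp
  ultimately have "(carrier Homeo - (\<Inter>k::nat. ?A (ennreal (2 - inverse (Suc k))))) \<union> ?A 2
      \<in> sets (borel_of Homeo_topology)"
    by (intro sets.Un sets.Diff sets.countable_INT) auto
  also have "(carrier Homeo - (\<Inter>k::nat. ?A (ennreal (2 - inverse (Suc k))))) \<union> ?A 2
      = {f \<in> carrier Homeo. graph_length f \<noteq> 2}"
    using 2 * by (auto intro: less_le_trans) (metis less_irrefl order_less_le)
  finally show ?thesis .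
qed

text \<open>Joint continuity is uniform on the compact set \<open>cball p 1 \<times> {0..1}\<close>,
  which makes \<open>\<Phi>\<close> continuous for the maximum metric.\<close>

lemma borel_measurable_Homeo_family:
  fixes \<Phi> :: "'a::heine_borel \<Rightarrow> real \<Rightarrow> real"
  assumes \<Phi>: "\<And>p. \<Phi> p \<in> carrier Homeo"
    and cont: "continuous_on (UNIV \<times> {0..1}) (\<lambda>(p, x). \<Phi> p x)"
  shows "\<Phi> \<in> borel \<rightarrow>\<^sub>M borel_of Homeo_topology"
  unfolding borel_of_def
proof (rule measurable_measure_of)
  fix U assume "U \<in> {U. openin Homeo_topology U}"
  then have U: "openin Homeo.mtopology U"
    by (simp add: Homeo_topology_def)
  have "open (\<Phi> -` U)"
    unfolding open_dist
  proof
    fix p assume "p \<in> \<Phi> -` U"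
    then obtain r where r: "0 < r" "Homeo.mball (\<Phi> p) r \<subseteq> U"
      using U by (auto simp: Homeo.openin_mtopology)
    have "uniformly_continuous_on (cball p 1 \<times> {0..1}) (\<lambda>(p, x). \<Phi> p x)"
      by (intro compact_uniformly_continuous continuous_on_subset[OF cont] compact_Times) auto
    then obtain d where d: "0 < d" "\<And>y z. y \<in> cball p 1 \<times> {0..1} \<Longrightarrow> z \<in> cball p 1 \<times> {0..1} \<Longrightarrow>
        dist z y < d \<Longrightarrow> dist ((\<lambda>(p, x). \<Phi> p x) z) ((\<lambda>(p, x). \<Phi> p x) y) < r / 2"
      using r(1) unfolding uniformly_continuous_on_def by (metis half_gt_zero)
    have "q \<in> \<Phi> -` U" if q: "dist q p < min d 1" for q
    proof -
      have "\<bar>\<Phi> p x - \<Phi> q x\<bar> \<le> r / 2" if "x \<in> {0..1}" for x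
        using d(2)[of "(q, x)" "(p, x)"] that q by (auto simp: dist_Pair_Pair dist_real_def dist_commute)
      then have "max_dist (\<Phi> p) (\<Phi> q) \<le> r / 2"
        using r(1) by (intro max_dist_leI) auto
      then have "\<Phi> q \<in> Homeo.mball (\<Phi> p) r"
        using r(1) \<Phi> by auto
      then show ?thesis
        using r(2) by auto
    qed
    then show "\<exists>e>0. \<forall>q. dist q p < e \<longrightarrow> q \<in> \<Phi> -` U"
      using d(1) by (intro exI[of _ "min d 1"]) auto
  qed
  then show "\<Phi> -` U \<inter> space borel \<in> sets borel"
    by (simp add: borel_open)
next
  show "{U. openin Homeo_topology U} \<subseteq> Pow (topspace Homeo_topology)"
    by (auto simp del: topspace_Homeo_topology dest: openin_subset)
qed (use \<Phi> in auto)

section \<open>The random singular homeomorphism\<close>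

lemma homeomorphism_powr_exp:
  "homeomorphism {0..1} {0..1} (\<lambda>x::real. x powr exp a) (\<lambda>x. x powr exp (- a))"
proof (rule homeomorphismI)
  show "continuous_on {0..1} (\<lambda>x::real. x powr exp a)"
    "continuous_on {0..1} (\<lambda>x::real. x powr exp (- a))"
    by (rule continuous_on_powr'; auto)+
  fix x :: real assume "x \<in> {0..1}"
  then show "(x powr exp a) powr exp (- a) = x" "(x powr exp (- a)) powr exp a = x"
    by (simp_all add: powr_powr flip: exp_add)
qed (auto simp: powr_le1)

text \<open>The outer exponent is negated because its inverse map,
  \<open>y powr exp (fst p)\<close>, is what has to avoid the null set on the range side.\<close>

definition coin_homeo :: "real \<times> real \<Rightarrow> real \<Rightarrow> real" where
  "coin_homeo p = (\<lambda>x\<in>{0..1}. coin_cdf (x powr exp (snd p)) powr exp (- fst p))"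

lemma coin_homeo_in_Homeo: "coin_homeo p \<in> carrier Homeo"
proof -
  obtain t where t: "homeomorphism {0..1} {0..1} coin_cdf t"
    using homeomorphism_coin_cdf by blast
  have "homeomorphism {0..1} {0..1} (coin_homeo p)
      ((\<lambda>x. x powr exp (- snd p)) \<circ> t \<circ> (\<lambda>x. x powr exp (fst p)))"
    by (rule homeomorphism_cong[OF homeomorphism_compose[OF homeomorphism_powr_exp[of "snd p"]
          homeomorphism_compose[OF t homeomorphism_powr_exp[of "- fst p", simplified]]]])
       (auto simp: coin_homeo_def)
  then show ?thesis
    by (auto simp: carrier_Homeo coin_homeo_def)
qed

lemma coin_cdf_in_unit: "x \<in> {0..1} \<Longrightarrow> coin_cdf x \<in> {0..1}"
  using homeomorphism_coin_cdf by (auto simp: homeomorphism_def)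

lemma measurable_coin_homeo: "coin_homeo \<in> borel \<rightarrow>\<^sub>M borel_of Homeo_topology"
proof (rule borel_measurable_Homeo_family)
  have "continuous_on (UNIV \<times> {0..1}) (\<lambda>z::(real \<times> real) \<times> real. snd z powr exp (snd (fst z)))"
    by (intro continuous_on_powr' continuous_intros) auto
  then have "continuous_on (UNIV \<times> {0..1}) (\<lambda>z::(real \<times> real) \<times> real. coin_cdf (snd z powr exp (snd (fst z))))"
    by (rule continuous_on_compose2[OF continuous_on_coin_cdf]) auto
  then have "continuous_on (UNIV \<times> {0..1}) (\<lambda>z::(real \<times> real) \<times> real.
      coin_cdf (snd z powr exp (snd (fst z))) powr exp (- fst (fst z)))"
    by (intro continuous_on_powr' continuous_intros)
       (use coin_cdf_in_unit in \<open>auto simp: powr_le1\<close>)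
  then show "continuous_on (UNIV \<times> {0..1}) (\<lambda>(p, x). coin_homeo p x)"
    by (rule continuous_on_eq) (auto simp: coin_homeo_def)
qed (rule coin_homeo_in_Homeo)

text \<open>
  A point \<open>x\<close> is bad if its image under the inner power map hits the null set \<open>N1\<close>; the inner
  exponent decides this alone. On the range side only the outer exponent matters.
\<close>

lemma AE_translate_singular:
  assumes g: "homeomorphism {0..1} {0..1} g g'" and h: "homeomorphism {0..1} {0..1} h' h"
  shows "AE p in lborel. \<forall>F. F \<in> carrier Homeo \<longrightarrow> (\<forall>x\<in>{0..1}. F x = g' (coin_homeo p (h' x))) \<longrightarrow>
    graph_length F = 2"
proof -
  obtain N1 N2 where N: "N1 \<in> null_sets lborel" "N2 \<in> null_sets lborel"
    and cover: "\<And>x. x \<in> {0..1} \<Longrightarrow> x \<in> N1 \<or> coin_cdf x \<in> N2"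
    using coin_cdf_singular by metis
  have inj: "inj_on k {0..1}" "continuous_on {0..1} k" "k \<in> {0..1} \<rightarrow> {0..1}"
    if "homeomorphism {0..1} {0..1} k k'" for k k' :: "real \<Rightarrow> real"
    using that by (auto simp: homeomorphism_def intro: inj_on_inverseI)
  define P where "P b \<longleftrightarrow> (AE x in lborel. x \<in> {0..1} \<longrightarrow> h' x powr exp b \<notin> N1)" for b
  define Q where "Q a \<longleftrightarrow> (AE y in lborel. y \<in> {0..1} \<longrightarrow> g y powr exp a \<notin> N2)" for a
  have P: "AE b in lborel. P b"
    unfolding P_def using N(1) inj[OF h] by (intro AE_AE_powr_exp_notin_null)
  have Q: "AE a in lborel. Q a"
    unfolding Q_def using N(2) inj[OF g] by (intro AE_AE_powr_exp_notin_null)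
  obtain NP NQ where NP: "NP \<in> null_sets lborel" "{b. \<not> P b} \<subseteq> NP"
    and NQ: "NQ \<in> null_sets lborel" "{a. \<not> Q a} \<subseteq> NQ"
    using P Q by (auto simp: eventually_ae_filter)
  \<comment> \<open>\<open>P\<close> and \<open>Q\<close> depend on one coordinate each, so the bad
    parameters lie in two null families of parallel lines.\<close>
  have "UNIV \<times> NP \<union> NQ \<times> UNIV \<in> null_sets (lborel \<Otimes>\<^sub>M lborel)"
    using NP(1) NQ(1) by (intro null_sets.Un lborel.times_in_null_sets1 lborel.times_in_null_sets2) auto
  then have "AE p in lborel \<Otimes>\<^sub>M lborel. P (snd p) \<and> Q (fst p)"
    by (rule AE_I') (use NP(2) NQ(2) in auto)
  then show ?thesis
    unfolding lborel_prod
  proof eventually_elim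
    case (elim p)
    show ?case
    proof (intro allI impI)
      fix F assume F: "F \<in> carrier Homeo" and eq: "\<forall>x\<in>{0..1}. F x = g' (coin_homeo p (h' x))"
      \<comment> \<open>\<open>M1\<close> and \<open>M2\<close> become the exceptional sets that
        witness the singularity of \<open>F\<close>.\<close>
      obtain M1 where M1: "M1 \<in> null_sets lborel"
        "\<And>x. x \<in> {0..1} \<Longrightarrow> h' x powr exp (snd p) \<in> N1 \<Longrightarrow> x \<in> M1"
        using elim unfolding P_def eventually_ae_filter by auto
      obtain M2 where M2: "M2 \<in> null_sets lborel"
        "\<And>y. y \<in> {0..1} \<Longrightarrow> g y powr exp (fst p) \<in> N2 \<Longrightarrow> y \<in> M2"
        using elim unfolding Q_def eventually_ae_filter by auto
      have "x \<in> M1 \<or> F x \<in> M2" if x: "x \<in> {0..1}" for x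
      proof -
        define u where "u = h' x powr exp (snd p)"
        have hx: "h' x \<in> {0..1}"
          using x h by (auto simp: homeomorphism_def)
        then have u: "u \<in> {0..1}" "coin_cdf u \<in> {0..1}"
          using coin_cdf_in_unit[of u] by (auto simp: u_def powr_le1)
        have "F x = g' (coin_cdf u powr exp (- fst p))"
          using eq x hx by (simp add: coin_homeo_def u_def)
        moreover have "coin_cdf u powr exp (- fst p) \<in> {0..1}"
          using u(2) by (auto simp: powr_le1)
        ultimately have "g (F x) = coin_cdf u powr exp (- fst p)" "F x \<in> {0..1}"
          using g by (auto simp: homeomorphism_def)
        then have "g (F x) powr exp (fst p) = coin_cdf u" "F x \<in> {0..1}"
          using u(2) by (simp_all add: powr_powr flip: exp_add)
        then show ?thesis
          using cover[OF u(1)] M1(2)[OF x] M2(2)[of "F x"] unfolding u_def by auto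
      qed
      moreover obtain G where "homeomorphism {0..1} {0..1} F G"
        using F by (auto simp: carrier_Homeo)
      ultimately show "graph_length F = 2"
        using M1(1) M2(1) by (intro graph_length_eq_2_if_singular)
    qed
  qed
qed

section \<open>The law of the random homeomorphism as a witness measure\<close>

theorem corollary6p1:
  shows "prevalent Homeo Homeo_topology {f \<in> carrier Homeo. graph_length f = 2}"
proof -
  define B where "B = {f \<in> carrier Homeo. graph_length f \<noteq> 2}"
  \<comment> \<open>The uniform distribution is absolutely continuous, so statements that hold for
    Lebesgue almost every parameter pair carry over to it.\<close>
  define M where "M = uniform_measure lborel (cbox (0, 0) (1, 1) :: (real \<times> real) set)"
  define \<mu> where "\<mu> = distr M (borel_of Homeo_topology) coin_homeo"
  have "emeasure lborel (cbox (0, 0) (1, 1) :: (real \<times> real) set) = 1"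
    by (subst emeasure_lborel_cbox_eq) (auto simp: Basis_prod_def)
  then have M: "prob_space M" "sets M = sets borel"
    unfolding M_def by (auto intro!: prob_space_uniform_measure)
  have meas: "coin_homeo \<in> M \<rightarrow>\<^sub>M borel_of Homeo_topology"
    using measurable_coin_homeo M(2) by (simp cong: measurable_cong_sets)
  have null: "emeasure \<mu> ((\<lambda>b. g \<otimes>\<^bsub>Homeo\<^esub> b \<otimes>\<^bsub>Homeo\<^esub> h) ` B) = 0"
    if gh: "g \<in> carrier Homeo" "h \<in> carrier Homeo" for g h
  proof (cases "(\<lambda>b. g \<otimes>\<^bsub>Homeo\<^esub> b \<otimes>\<^bsub>Homeo\<^esub> h) ` B \<in> sets \<mu>")
    case True
    interpret Homeo_group: group Homeo
      by (rule group_Homeo)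
    obtain g' h' where g': "homeomorphism {0..1} {0..1} g g'" and h': "homeomorphism {0..1} {0..1} h h'"
      using gh by (auto simp: carrier_Homeo)
    \<comment> \<open>If \<open>coin_homeo p\<close> lies in the translate, solving for
      \<open>b\<close> gives \<open>g' \<circ> coin_homeo p \<circ> h'\<close> on
      \<open>{0..1}\<close>, which almost surely has graph length 2, whereas \<open>b\<close> is in
      \<open>B\<close>.\<close>
    have "AE p in lborel. coin_homeo p \<notin> (\<lambda>b. g \<otimes>\<^bsub>Homeo\<^esub> b \<otimes>\<^bsub>Homeo\<^esub> h) ` B"
      using AE_translate_singular[OF g' homeomorphism_symD[OF h']]
    proof eventually_elim
      case (elim p)
      show ?case
      proof
        assume "coin_homeo p \<in> (\<lambda>b. g \<otimes>\<^bsub>Homeo\<^esub> b \<otimes>\<^bsub>Homeo\<^esub> h) ` B"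
        then obtain b where b: "b \<in> carrier Homeo" "graph_length b \<noteq> 2"
          and p: "coin_homeo p = g \<otimes>\<^bsub>Homeo\<^esub> b \<otimes>\<^bsub>Homeo\<^esub> h"
          by (auto simp: B_def)
        have "b x = g' (coin_homeo p (h' x))" if x: "x \<in> {0..1}" for x
        proof -
          have "h' x \<in> {0..1}" "h (h' x) = x"
            using h' x by (auto simp: homeomorphism_def)
          then have "coin_homeo p (h' x) = g (b x)"
            using x mult_Homeo[OF gh(1) b(1)] mult_Homeo[OF Homeo_group.m_closed[OF gh(1) b(1)] gh(2)]
            by (simp add: p compose_def)
          then show ?thesis
            using g' Homeo_into_unit[OF b(1) x] by (simp add: homeomorphism_def)
        qed
        then show False
          using elim b by auto
      qed
    qed
    then have "AE p in M. coin_homeo p \<notin> (\<lambda>b. g \<otimes>\<^bsub>Homeo\<^esub> b \<otimes>\<^bsub>Homeo\<^esub> h) ` B"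
      unfolding M_def by (intro AE_uniform_measureI) auto
    moreover have "coin_homeo -` ((\<lambda>b. g \<otimes>\<^bsub>Homeo\<^esub> b \<otimes>\<^bsub>Homeo\<^esub> h) ` B) \<inter> space M \<in> sets M"
      using True by (intro measurable_sets[OF meas]) (simp add: \<mu>_def)
    ultimately have "emeasure M (coin_homeo -` ((\<lambda>b. g \<otimes>\<^bsub>Homeo\<^esub> b \<otimes>\<^bsub>Homeo\<^esub> h) ` B) \<inter> space M) = 0"
      by (subst AE_iff_measurable[symmetric]) auto
    then show ?thesis
      using True unfolding \<mu>_def by (subst emeasure_distr[OF meas]) simp_all
  next
    \<comment> \<open>This case does not occur, but the value 0 on non-measurable sets settles it.\<close>
    case False
    then show ?thesis
      by (rule emeasure_notin_sets)
  qed
  have "prob_space \<mu>"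
    unfolding \<mu>_def by (rule prob_space.prob_space_distr[OF M(1) meas])
  moreover have "sets \<mu> = sets (borel_of Homeo_topology)"
    by (simp add: \<mu>_def)
  moreover have "B \<in> sets (borel_of Homeo_topology)"
    unfolding B_def by (rule borel_graph_length_neq_2)
  moreover have "carrier Homeo - {f \<in> carrier Homeo. graph_length f = 2} \<subseteq> B"
    by (auto simp: B_def)
  ultimately show ?thesis
    using null unfolding prevalent_def haar_null_def by blast
qed

end
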